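(* Let $p,q\in\mathbb{C}$ be nonzero, written as $p=c(1+\epsilon)$ and $q=c(1-\epsilon)$ with $\epsilon\in\mathbb{C}$ and $c\in\mathbb{C}$, $c\neq 0$, and let $$X=\begin{pmatrix} p & p\\ q & -q\end{pmatrix}.$$ If $\sum_{i=1}^{2}|X_{ij}|^2=1$ for all $j\in\{1,2\}$ and $\sum_{i=1}^{2}|X_{ji}|^2=1$ for all $j\in\{1,2\}$, then $\mathrm{Re}(\epsilon)=0$, and thus $X$ is unitary.
   Context: The matrix $X$ is the "neutral meson matrix" (under CPT invariance): it is the change-of-basis matrix whose columns are the coordinates, in the orthonormal flavour basis, of the two eigenvectors of the effective $2\times 2$ (non-hermitian) Hamiltonian, so that $X^T=\begin{pmatrix} p & q\\ p & -q\end{pmatrix}$. The complex parameter $\epsilon$ is defined by $(p,q)$ being proportional to $(1+\epsilon,1-\epsilon)$, the constant $c$ being the normalization constant. As a change-of-basis matrix $X$ is invertible, i.e. $p,q\neq0$. *)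

theory Defs
  imports "HOL-Analysis.Analysis"
begin

definition conj_transpose :: "complex^'n^'m \<Rightarrow> complex^'m^'n" where
  "conj_transpose A = transpose (map_matrix cnj A)"

definition unitary_matrix :: "complex^'n^'n \<Rightarrow> bool" where
  "unitary_matrix U \<longleftrightarrow>
     conj_transpose U ** U = mat 1 \<and> U ** conj_transpose U = mat 1"

(* The outer vector lists the rows, so the columns are (p, q) and (p, -q). *)
definition neutral_meson_matrix :: "complex \<Rightarrow> complex \<Rightarrow> complex^2^2" where
  "neutral_meson_matrix p q =
     vector [vector [p,  p],
             vector [q, - q]]"

end

theory Submission
  imports Defs
begin

text \<open>Each row of \<open>X\<close> repeats one number up to sign, so unit rows force |p|^2 =
  |q|^2 = 1/2. Cancelling c, \<epsilon> is equidistant from 1 and -1, hence purely imaginary. The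
  rows are orthogonal because of the sign of -q, and the columns because their inner product is
  |p|^2 - |q|^2 = 0.\<close>

theorem proposition3p1:
  fixes p q c \<epsilon> :: complex and X :: "complex^2^2"
  assumes "p \<noteq> 0" and "q \<noteq> 0" and "c \<noteq> 0"
    and "p = c * (1 + \<epsilon>)" and "q = c * (1 - \<epsilon>)"
    and "X = neutral_meson_matrix p q"
    and "\<forall>j. (\<Sum>i\<in>UNIV. (cmod (X $ i $ j))\<^sup>2) = 1"
    and "\<forall>j. (\<Sum>i\<in>UNIV. (cmod (X $ j $ i))\<^sup>2) = 1"
  shows "Re \<epsilon> = 0 \<and> unitary_matrix X"
proof -
  have "2 * (cmod p)\<^sup>2 = 1" and "2 * (cmod q)\<^sup>2 = 1"
    using assms(8) by (simp_all add: assms(6) neutral_meson_matrix_def sum_2 forall_2)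
  then have p: "(cmod p)\<^sup>2 = 1 / 2" and q: "(cmod q)\<^sup>2 = 1 / 2"
    by simp_all
  have "(cmod c)\<^sup>2 * (cmod (1 + \<epsilon>))\<^sup>2 = (cmod c)\<^sup>2 * (cmod (1 - \<epsilon>))\<^sup>2"
    using p q unfolding assms(4,5) norm_mult power_mult_distrib by (rule trans[OF _ sym])
  then have "(cmod (1 + \<epsilon>))\<^sup>2 = (cmod (1 - \<epsilon>))\<^sup>2"
    using assms(3) by simp
  \<comment> \<open>The two squared moduli differ by 4 \<open>Re \<epsilon>\<close>.\<close>
  then have "Re \<epsilon> = 0"
    unfolding cmod_power2 by (simp add: power2_eq_square algebra_simps)
  \<comment> \<open>Moduli become products with conjugates, so that both matrix equations of
    unitarity turn into polynomial identities in \<open>p\<close>, \<open>q\<close> and their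
    conjugates.\<close>
  moreover have "p * cnj p = 1 / 2" and "q * cnj q = 1 / 2"
    unfolding complex_norm_square[symmetric] p q by simp_all
  then have "unitary_matrix X"
    by (simp add: assms(6) unitary_matrix_def conj_transpose_def neutral_meson_matrix_def
        map_matrix_def transpose_def matrix_matrix_mult_def mat_def vec_eq_iff forall_2 sum_2
        mult.commute) algebra
  ultimately show ?thesis ..
qed

end
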